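(* There exists a constant $\mathcal{C}$ such that the following is true for all sufficiently large $n$. Let $m$ be a positive integer with $2m\ge\exp(\mathcal{C}\cdot(\log\log n)^2)$, and let $I,J\subseteq[n]=\{1,\dots,n\}$ each be a set of $2m$ consecutive integers. Then for all subsets $S\subseteq I$, $T\subseteq J$ with $|S|+|T|\ge 2m$, exactly one of the following happens: (1) $S=\emptyset$; (2) $T=\emptyset$; (3) $S=I\cap 2\mathbb{Z}$ and $T=J\cap 2\mathbb{Z}$; (4) there exist $s\in S$, $t\in T$ that are coprime. In particular, if $|S|+|T|>2m$ then there exist coprime $s\in S$, $t\in T$. *)

theory Defs
  imports Complex_Main
begin

definition exactly_one :: "bool list \<Rightarrow> bool" where
  "exactly_one ps \<longleftrightarrow> (\<exists>!i. i < length ps \<and> ps ! i)"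

text \<open>Sets of consecutive integers are taken inside \<^typ>\<open>nat\<close>, since they are only
  used for subsets of \<^term>\<open>{1..n}\<close>.\<close>

definition consecutive :: "nat \<Rightarrow> nat set \<Rightarrow> bool" where
  "consecutive k I \<longleftrightarrow> (\<exists>a. I = {a..<a + k})"

end

theory Submission
  imports Defs "HOL-Number_Theory.Cong"
begin

text \<open>
  Split \<open>I\<close> and \<open>J\<close> by parity. It suffices to show that nonempty subsets \<open>A\<close>, \<open>B\<close> of two parity
  classes, such that any \<open>a \<in> A\<close> and \<open>b \<in> B\<close> share an odd prime, satisfy \<open>|A| + |B| < m\<close>.
  Suppose not, and let \<open>\<beta> = |B| / m \<le> 1/2\<close>. For \<open>a \<in> A\<close>, the union bound gives \<open>\<beta> \<le> \<Sum> 1/p\<close>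
  over the odd primes \<open>p\<close> dividing \<open>a\<close>, up to a small error. If the density \<open>D\<close> of the numbers
  without odd prime factor up to \<open>y\<close> is at least \<open>2 * \<beta>\<close>, then \<open>A\<close> contains many of these numbers,
  and averaging over them gives \<open>\<beta> * (D - \<beta>) \<le> D * (\<Sum>p>y. 1/p\<^sup>2)\<close>, up to a small error. This is strong
  enough to pass from \<open>y\<close> to the next prime. When \<open>y\<close> reaches about \<open>4 * ln n\<close>, the bound on \<open>\<beta>\<close> is of
  order \<open>1 / ln n\<close>, whereas a single \<open>b \<in> B\<close>, having at most \<open>log 2 n\<close> prime factors, forces \<open>\<beta>\<close> to
  be at least of order \<open>1 / sqrt (ln n)\<close>. The densities come from Brun's pure sieve of depth of order
  \<open>ln (ln n)\<close>, whose error \<open>(ln n) ^ O(ln (ln n))\<close> accounts for the lower bound on \<open>m\<close>.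
\<close>

subsection \<open>Sieving by odd primes\<close>

definition sift :: "nat set \<Rightarrow> nat set \<Rightarrow> nat set" where
  "sift Q X = {x \<in> X. \<forall>q\<in>Q. \<not> q dvd x}"

definition dens :: "nat set \<Rightarrow> real" where
  "dens Q = (\<Prod>q\<in>Q. 1 - 1 / real q)"

definition odd_primes :: "nat set" where
  "odd_primes = {p. prime p \<and> odd p}"

text \<open>This models one parity class in \<open>2 * m\<close> consecutive integers. Only odd
  moduli can be expected to be equidistributed there; the error stays at most 1 even when
  \<open>d\<close> exceeds \<open>m\<close>.\<close>

definition equidist :: "nat \<Rightarrow> nat set \<Rightarrow> bool" where
  "equidist m X \<longleftrightarrow> finite X \<and> card X = m \<and>
     (\<forall>d. odd d \<longrightarrow> \<bar>real (card {x \<in> X. d dvd x}) - real m / real d\<bar> \<le> 1)"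

section \<open>Brun's pure sieve for a finite set of sifting elements\<close>

lemma dens_bounds:
  assumes "\<forall>q\<in>Q. q > 0"
  shows "0 \<le> dens Q" "dens Q \<le> 1"
  using assms unfolding dens_def by (auto intro!: prod_nonneg prod_le_1)

text \<open>The left side consists of two terms of the binomial expansion. This recombines both
  error terms of the sieve when a sifting element is added.\<close>

lemma power_add_ge:
  fixes a b :: real
  assumes "a \<ge> 0" "b \<ge> 0"
  shows "a ^ Suc k + real (Suc k) * a ^ k * b \<le> (a + b) ^ Suc k"
proof (induction k)
  case (Suc k)
  have "a ^ Suc (Suc k) + real (Suc (Suc k)) * a ^ Suc k * b
      \<le> (a + b) * (a ^ Suc k + real (Suc k) * a ^ k * b)"
    using assms by (simp add: algebra_simps)
  also have "\<dots> \<le> (a + b) * (a + b) ^ Suc k"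
    using Suc assms by (intro mult_left_mono) auto
  finally show ?case by simp
qed simp

text \<open>Brun's pure sieve: the inclusion-exclusion formula truncated at depth \<open>k\<close>. The depth is
  lowered by one whenever the induction passes to the multiples of a new sifting element.\<close>

lemma truncated_sieve:
  fixes M :: real
  assumes "finite Q" "finite X" "\<forall>q\<in>Q. q > 0" "M \<ge> 0"
    and "\<And>D. D \<subseteq> Q \<Longrightarrow> \<bar>real (card {x \<in> X. \<forall>q\<in>D. q dvd x}) - M / real (\<Prod>D)\<bar> \<le> 1"
  shows "\<bar>real (card (sift Q X)) - M * dens Q\<bar>
    \<le> M * ((\<Sum>q\<in>Q. 1 / real q) ^ k / fact k) + real (card Q + 1) ^ k"
  using assms
proof (induction Q arbitrary: X M k rule: finite_induct)
  case empty
  have "\<bar>real (card X) - M\<bar> \<le> 1" using empty(4)[of "{}"] by simp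
  then show ?case using empty(3) by (cases k) (auto simp: sift_def dens_def)
next
  case (insert p Q)
  note IH = insert.IH and fin = \<open>finite X\<close> and pos = insert.prems(2) and M = \<open>0 \<le> M\<close>
    and acc = insert.prems(4)
  show ?case
  proof (cases k)
    case 0
    \<comment> \<open>At depth 0 the trivial bound suffices: both quantities lie between 0 and
      \<open>M + 1\<close>.\<close>
    have "\<bar>real (card X) - M\<bar> \<le> 1" using acc[of "{}"] by simp
    moreover have "card (sift (insert p Q) X) \<le> card X"
      using fin by (intro card_mono) (auto simp: sift_def)
    moreover have "0 \<le> M * dens (insert p Q)" "M * dens (insert p Q) \<le> M"
      using dens_bounds[OF pos] M by (auto intro: mult_left_le)
    ultimately show ?thesis using 0 M by auto
  next
    case (Suc l)
    define Xp where "Xp = {x \<in> X. p dvd x}"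
    define \<sigma> where "\<sigma> = (\<Sum>q\<in>Q. 1 / real q)"
    have \<sigma>: "\<sigma> \<ge> 0" unfolding \<sigma>_def by (intro sum_nonneg) auto
    have p: "p > 0" using pos by simp
    have 1: "\<bar>real (card (sift Q X)) - M * dens Q\<bar> \<le> M * (\<sigma> ^ k / fact k) + real (card Q + 1) ^ k"
      unfolding \<sigma>_def using acc M pos fin by (intro IH) auto
    have 2: "\<bar>real (card (sift Q Xp)) - M / p * dens Q\<bar>
        \<le> M / p * (\<sigma> ^ l / fact l) + real (card Q + 1) ^ l"
      unfolding \<sigma>_def
    proof (rule IH)
      fix D assume D: "D \<subseteq> Q"
      have "{x \<in> X. \<forall>q\<in>insert p D. q dvd x} = {x \<in> Xp. \<forall>q\<in>D. q dvd x}"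
        unfolding Xp_def by auto
      moreover have "\<Prod>(insert p D) = p * \<Prod>D"
        using D insert.hyps by (subst prod.insert) (auto dest: finite_subset)
      ultimately show "\<bar>real (card {x \<in> Xp. \<forall>q\<in>D. q dvd x}) - M / p / real (\<Prod>D)\<bar> \<le> 1"
        using acc[of "insert p D"] D by auto
    qed (use fin pos M Xp_def in auto)
    \<comment> \<open>Legendre's identity: sifting by \<open>p\<close> as well removes exactly the
      multiples of \<open>p\<close> that survive \<open>Q\<close>.\<close>
    have sub: "sift Q Xp \<subseteq> sift Q X" and eq: "sift (insert p Q) X = sift Q X - sift Q Xp"
      unfolding sift_def Xp_def by auto
    have finq: "finite (sift Q X)" using fin unfolding sift_def by simp
    have card: "real (card (sift (insert p Q) X)) = real (card (sift Q X)) - real (card (sift Q Xp))"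
      unfolding eq using sub finq by (simp add: card_Diff_subset finite_subset card_mono of_nat_diff)
    have dens: "M * dens (insert p Q) = M * dens Q - M / p * dens Q"
      unfolding dens_def using insert.hyps by (simp add: algebra_simps)
    have sum: "(\<Sum>q\<in>insert p Q. 1 / real q) = \<sigma> + 1 / p"
      unfolding \<sigma>_def using insert.hyps by simp
    \<comment> \<open>Since \<open>k = Suc l\<close>, the two truncation errors are two terms of the
      expansion of \<open>(\<sigma> + 1 / p) ^ k / fact k\<close>. The counting errors below combine
      in the same way.\<close>
    have "M * (\<sigma> ^ k / fact k) + M / p * (\<sigma> ^ l / fact l)
        = M * ((\<sigma> ^ Suc l + real (Suc l) * \<sigma> ^ l * (1 / p)) / fact k)"
      using Suc by (simp add: field_simps del: of_nat_Suc)
    also have "\<dots> \<le> M * ((\<sigma> + 1 / p) ^ Suc l / fact k)"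
      using M \<sigma> by (intro mult_left_mono divide_right_mono power_add_ge) auto
    finally have E: "M * (\<sigma> ^ k / fact k) + M / p * (\<sigma> ^ l / fact l)
        \<le> M * ((\<sigma> + 1 / p) ^ k / fact k)" using Suc by simp
    have "real (card Q + 1) ^ k + real (card Q + 1) ^ l
        \<le> real (card Q + 1) ^ Suc l + real (Suc l) * real (card Q + 1) ^ l * 1"
      using Suc by simp
    also have "\<dots> \<le> (real (card Q + 1) + 1) ^ Suc l" by (intro power_add_ge) auto
    finally have N: "real (card Q + 1) ^ k + real (card Q + 1) ^ l \<le> real (card (insert p Q) + 1) ^ k"
      using Suc insert.hyps by (simp add: add_ac)
    show ?thesis using 1 2 E N unfolding card dens sum by linarith
  qed
qed

section \<open>Equidistribution of parity classes modulo odd numbers\<close>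

lemma card_periodic:
  assumes "N > 0" and "\<And>a. card {x \<in> {a..<a + N}. R x} = 1"
  shows "\<bar>real (card {x \<in> {a..<a + L}. R x}) - real L / real N\<bar> \<le> 1"
proof (induction L arbitrary: a rule: less_induct)
  case (less L)
  show ?case
  proof (cases "L < N")
    case True
    have "card {x \<in> {a..<a + L}. R x} \<le> card {x \<in> {a..<a + N}. R x}"
      using True by (intro card_mono) auto
    then have "card {x \<in> {a..<a + L}. R x} \<le> 1" using assms(2) by simp
    moreover have "real L / real N \<le> 1" "0 \<le> real L / real N" using True by auto
    ultimately show ?thesis by linarith
  next
    case False
    \<comment> \<open>One full period is split off. It contributes exactly 1 to both sides, so the
      error is that of a shorter window with a shifted start.\<close>
    have "{x \<in> {a..<a + L}. R x} = {x \<in> {a..<a + N}. R x} \<union> {x \<in> {a + N..<a + N + (L - N)}. R x}"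
      using False by auto
    then have "card {x \<in> {a..<a + L}. R x} = 1 + card {x \<in> {a + N..<a + N + (L - N)}. R x}"
      using assms(2) by (simp add: card_Un_disjoint disjoint_iff)
    moreover have "real L / real N = 1 + real (L - N) / real N"
      using False assms(1) by (simp add: of_nat_diff field_simps)
    ultimately show ?thesis using less[of "L - N" "a + N"] False assms(1) by simp
  qed
qed

lemma card_residue_block:
  assumes "N > (0::nat)"
  shows "card {x \<in> {a..<a + N}. [x = r] (mod N)} = 1"
proof -
  let ?f = "\<lambda>x. x mod N"
  have inj: "inj_on ?f {a..<a + N}"
  proof (rule inj_onI)
    fix x y assume "x \<in> {a..<a + N}" "y \<in> {a..<a + N}" "x mod N = y mod N"
    then show "x = y"
    proof (induction x y rule: linorder_wlog)
      case (le x y)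
      then have "N dvd y - x" by (metis mod_eq_dvd_iff_nat)
      moreover have "y - x < N" using le by auto
      ultimately show ?case using le by (metis diff_is_0_eq' dvd_imp_le le_antisym linorder_not_less not_gr_zero diff_is_0_eq)
    qed auto
  qed
  have "?f ` {a..<a + N} = {..<N}"
    using assms by (intro card_subset_eq) (auto simp: card_image[OF inj])
  then obtain x where x: "x \<in> {a..<a + N}" "x mod N = r mod N"
    using assms by (metis (no_types, lifting) imageE lessThan_iff mod_less_divisor)
  then have "{x \<in> {a..<a + N}. [x = r] (mod N)} = {x}"
    using inj_onD[OF inj] by (auto simp: cong_def)
  then show ?thesis by simp
qed

text \<open>For odd \<open>d\<close>, the Chinese remainder theorem merges the parity condition and
  divisibility by \<open>d\<close> into one residue class modulo \<open>2 * d\<close>, and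
  \<open>2 * m / (2 * d) = m / d\<close>.\<close>

lemma equidist_parity_class:
  assumes "e < (2::nat)"
  shows "equidist m {x \<in> {a..<a + 2 * m}. x mod 2 = e}"
proof -
  have main: "\<bar>real (card {x \<in> {a..<a + 2 * m}. x mod 2 = e \<and> d dvd x}) - real m / real d\<bar> \<le> 1"
    if d: "odd d" for d
  proof -
    have cop: "coprime 2 d" using d by simp
    obtain r where r: "[r = e] (mod 2)" "[r = 0] (mod d)"
      using binary_chinese_remainder_nat[OF cop] by blast
    have "x mod 2 = e \<and> d dvd x \<longleftrightarrow> [x = r] (mod (2 * d))" for x
    proof -
      have "x mod 2 = e \<longleftrightarrow> [x = r] (mod 2)" using r(1) assms by (simp add: cong_def)
      moreover have "d dvd x \<longleftrightarrow> [x = r] (mod d)" using r(2) by (simp add: cong_def dvd_eq_mod_eq_0)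
      ultimately show ?thesis
        using cop by (metis coprime_cong_mult_nat cong_modulus_mult_nat mult.commute)
    qed
    moreover have "2 * d > 0" using d by (auto elim: oddE)
    ultimately show ?thesis
      using card_periodic[of "2 * d" "\<lambda>x. x mod 2 = e \<and> d dvd x" a "2 * m"]
        card_residue_block[of "2 * d"] by simp
  qed
  have "card {x \<in> {a..<a + 2 * m}. x mod 2 = e} = m"
  proof (induction m)
    case (Suc m)
    \<comment> \<open>Of the two new integers, \<open>a + 2 * m\<close> has the parity of
      \<open>a\<close> and the next one has the other.\<close>
    have "{x \<in> {a..<a + 2 * Suc m}. x mod 2 = e}
        = insert (if a mod 2 = e then a + 2 * m else a + 2 * m + 1) {x \<in> {a..<a + 2 * m}. x mod 2 = e}"
      using assms by (auto split: if_splits) presburger+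
    then show ?case using Suc by (auto simp: card_insert_if)
  qed simp
  then show ?thesis unfolding equidist_def using main by (simp add: conj_assoc)
qed

lemma odd_primes_ge3: "p \<in> odd_primes \<Longrightarrow> p \<ge> 3"
  unfolding odd_primes_def using prime_ge_2_nat[of p] by (cases "p = 2") auto

text \<open>The case \<open>p = 1\<close> sieves \<open>X\<close> itself, the other case its
  multiples of a prime outside \<open>Q\<close>. In both cases \<open>p\<close> is odd and coprime
  to every product of elements of \<open>Q\<close>, so equidistribution modulo
  \<open>p * \<Prod>D\<close> supplies the accuracy that the sieve needs.\<close>

lemma sieve_odd_primes:
  assumes X: "equidist m X" and Q: "finite Q" "Q \<subseteq> odd_primes"
    and p: "p = 1 \<or> p \<in> odd_primes - Q"
  shows "\<bar>real (card (sift Q {x \<in> X. p dvd x})) - real m / p * dens Q\<bar>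
    \<le> real m / p * ((\<Sum>q\<in>Q. 1 / real q) ^ k / fact k) + real (card Q + 1) ^ k"
proof (rule truncated_sieve)
  fix D assume D: "D \<subseteq> Q"
  then have fD: "finite D" using Q finite_subset by blast
  have cop: "coprime q (\<Prod>F)" if "F \<subseteq> Q" "q \<notin> F" "q = 1 \<or> q \<in> odd_primes" for F q
  proof (cases "q = 1")
    case False
    then show ?thesis
      using that Q by (intro prod_coprime_right) (auto simp: odd_primes_def subset_iff intro!: primes_coprime)
  qed simp
  have prod_dvd: "\<Prod>D dvd x \<longleftrightarrow> (\<forall>q\<in>D. q dvd x)" for x
    using fD D
  proof (induction D rule: finite_induct)
    case (insert q D)
    have "coprime q (\<Prod>D)" using insert Q by (intro cop) auto
    then have "q * \<Prod>D dvd x \<longleftrightarrow> q dvd x \<and> \<Prod>D dvd x"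
      by (auto intro: divides_mult dest: dvd_mult_left dvd_mult_right)
    then show ?case using insert by simp
  qed simp
  have "p \<notin> D" using p D Q by (auto simp: odd_primes_def)
  then have "coprime p (\<Prod>D)" using D p by (intro cop) auto
  then have "p * \<Prod>D dvd x \<longleftrightarrow> p dvd x \<and> (\<forall>q\<in>D. q dvd x)" for x
    unfolding prod_dvd[symmetric] by (auto intro: divides_mult dest: dvd_mult_left dvd_mult_right)
  moreover have "odd (\<Prod>D)" using fD D Q by (induction D rule: finite_induct) (auto simp: odd_primes_def)
  then have "odd (p * \<Prod>D)" using p by (auto simp: odd_primes_def)
  then have "\<bar>real (card {x \<in> X. p * \<Prod>D dvd x}) - real m / real (p * \<Prod>D)\<bar> \<le> 1"
    using X unfolding equidist_def by blast
  ultimately show "\<bar>real (card {x \<in> {x \<in> X. p dvd x}. \<forall>q\<in>D. q dvd x}) - real m / p / real (\<Prod>D)\<bar> \<le> 1"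
    by (simp add: conj_assoc)
next
  show "\<forall>q\<in>Q. q > 0" using Q odd_primes_ge3 by fastforce
qed (use X Q in \<open>auto simp: equidist_def\<close>)

section \<open>Bounds for densities and for sums over primes\<close>

lemma card_odd_ge3_le:
  assumes "Q \<subseteq> {x. odd x \<and> 3 \<le> x \<and> x \<le> (N::nat)}"
  shows "2 * card Q + 1 \<le> N \<or> Q = {}"
proof -
  have "Q \<subseteq> (\<lambda>i. 2 * i + 1) ` {1..(N - 1) div 2}"
  proof
    fix x assume "x \<in> Q"
    then have x: "odd x" "3 \<le> x" "x \<le> N" using assms by auto
    then obtain i where "x = 2 * i + 1" by (elim oddE)
    then show "x \<in> (\<lambda>i. 2 * i + 1) ` {1..(N - 1) div 2}" using x by auto
  qed
  then have "card Q \<le> card ((\<lambda>i. 2 * i + 1) ` {1..(N - 1) div 2})"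
    by (intro card_mono) auto
  also have "\<dots> \<le> (N - 1) div 2" using card_image_le[of "{1..(N - 1) div 2}" "\<lambda>i. 2 * i + 1"] by simp
  finally have "card Q \<le> (N - 1) div 2" .
  moreover have "N \<ge> 1" if "Q \<noteq> {}" using that assms by fastforce
  ultimately show ?thesis by fastforce
qed

text \<open>A telescoping bound, which replaces Mertens' theorem throughout.\<close>

lemma dens_sq_ge:
  assumes "finite Q" "\<forall>q\<in>Q. odd q \<and> 3 \<le> q"
  shows "1 / real (2 * card Q + 1) \<le> (dens Q)\<^sup>2"
  using assms
proof (induction Q rule: finite_linorder_max_induct)
  case (insert b Q)
  let ?c = "real (card Q)"
  have nb: "b \<notin> Q" using insert by auto
  \<comment> \<open>The largest of \<open>c\<close> distinct odd numbers from 3 on is at least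
    \<open>2 * c + 1\<close>.\<close>
  have "2 * card (insert b Q) + 1 \<le> b"
    using insert card_odd_ge3_le[of "insert b Q" b] by fastforce
  then have b: "2 * ?c + 3 \<le> real b" using insert nb by simp
  \<comment> \<open>At \<open>t = 2 * ?c + 3\<close> the left side is the quotient of two successive
    lower bounds, which makes the product telescope.\<close>
  have "(t - 2) / t \<le> (1 - 1 / t)\<^sup>2" if "t > 0" for t :: real
    using that by (simp add: field_simps power2_eq_square)
  from this[of "2 * ?c + 3"] have "(2 * ?c + 1) / (2 * ?c + 3) \<le> (1 - 1 / (2 * ?c + 3))\<^sup>2"
    by (simp add: add_ac)
  also have "\<dots> \<le> (1 - 1 / real b)\<^sup>2"
    using b by (intro power_mono diff_left_mono divide_left_mono) auto
  finally have 1: "(2 * ?c + 1) / (2 * ?c + 3) \<le> (1 - 1 / real b)\<^sup>2" .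
  have "1 / real (2 * card (insert b Q) + 1) = (2 * ?c + 1) / (2 * ?c + 3) * (1 / (2 * ?c + 1))"
    using insert nb by (simp add: field_simps)
  also have "\<dots> \<le> (1 - 1 / real b)\<^sup>2 * (dens Q)\<^sup>2"
    using insert 1 by (intro mult_mono) (auto simp: add_ac)
  also have "\<dots> = (dens (insert b Q))\<^sup>2"
    using insert nb by (simp add: dens_def power_mult_distrib)
  finally show ?case .
qed (simp add: dens_def)

lemma dens_ge:
  assumes "finite Q" "Q \<subseteq> odd_primes" "card Q \<le> c"
  shows "1 / sqrt (real (2 * c + 1)) \<le> dens Q"
proof -
  have *: "\<forall>q\<in>Q. odd q \<and> 3 \<le> q" using assms odd_primes_ge3 by (auto simp: odd_primes_def)
  have "1 / real (2 * c + 1) \<le> 1 / real (2 * card Q + 1)" using assms by (intro divide_left_mono) auto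
  also have "\<dots> \<le> (dens Q)\<^sup>2" using * assms by (intro dens_sq_ge) auto
  finally have "sqrt (1 / real (2 * c + 1)) \<le> dens Q"
    by (intro real_le_lsqrt dens_bounds) (use * in auto)
  then show ?thesis by (simp add: real_sqrt_divide)
qed

text \<open>By \<open>1 - 1 / q \<le> exp (- (1 / q))\<close>, the lower bound for the density
  becomes an upper bound for the sum.\<close>

lemma sum_inverse_le:
  assumes "finite Q" "Q \<subseteq> odd_primes" "card Q \<le> c"
  shows "(\<Sum>q\<in>Q. 1 / real q) \<le> ln (real (2 * c + 1)) / 2"
proof -
  have "1 / sqrt (real (2 * c + 1)) \<le> dens Q" using assms by (rule dens_ge)
  also have "dens Q \<le> (\<Prod>q\<in>Q. exp (- (1 / real q)))"
    unfolding dens_def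
  proof (intro prod_mono conjI)
    fix q assume "q \<in> Q"
    then have "q \<ge> 3" using assms odd_primes_ge3 by auto
    then show "0 \<le> 1 - 1 / real q" by simp
    show "1 - 1 / real q \<le> exp (- (1 / real q))" using exp_ge_add_one_self[of "- (1 / real q)"] by simp
  qed
  also have "\<dots> = exp (- (\<Sum>q\<in>Q. 1 / real q))" using assms by (simp add: exp_sum sum_negf[symmetric])
  finally have "ln (1 / sqrt (real (2 * c + 1))) \<le> ln (exp (- (\<Sum>q\<in>Q. 1 / real q)))"
    by (subst ln_le_cancel_iff) auto
  moreover have "ln (1 / sqrt (real (2 * c + 1))) = - (ln (real (2 * c + 1)) / 2)"
    by (subst ln_div) (auto simp: ln_sqrt)
  ultimately show ?thesis by simp
qed

text \<open>The sum is enlarged to all odd numbers above \<open>2 * j + 1\<close>, where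
  \<open>1 / (2 * t + 1)\<^sup>2\<close> is at most the telescoping difference
  \<open>1 / (4 * t) - 1 / (4 * t + 4)\<close>.\<close>

lemma sum_inverse_squares_le:
  fixes j :: nat
  assumes "finite F" "\<forall>p\<in>F. odd p \<and> 2 * j + 1 < p"
  shows "(\<Sum>p\<in>F. 1 / (real p)\<^sup>2) \<le> 1 / (4 * real j + 4)"
proof -
  have *: "(\<Sum>i=j+1..<j+1+l. 1 / (real (2 * i + 1))\<^sup>2) \<le> 1 / (4 * real j + 4) - 1 / (4 * real (j + l) + 4)" for l
  proof (induction l)
    case (Suc l)
    have "1 / (2 * t + 1)\<^sup>2 \<le> 1 / (4 * t) - 1 / (4 * t + 4)" if "t > 0" for t :: real
    proof -
      have "1 / (2 * t + 1)\<^sup>2 \<le> 1 / (4 * t * (t + 1))"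
        using that by (intro divide_left_mono) (auto simp: power2_eq_square algebra_simps add_pos_pos)
      also have "\<dots> = 1 / (4 * t) - 1 / (4 * t + 4)"
        using that by (simp add: field_simps)
      finally show ?thesis .
    qed
    from this[of "real (j + l) + 1"]
    have "1 / (real (2 * (j + 1 + l) + 1))\<^sup>2 \<le> 1 / (4 * real (j + l) + 4) - 1 / (4 * real (j + Suc l) + 4)"
      by (simp add: algebra_simps)
    then show ?case using Suc by simp
  qed simp
  obtain l where l: "\<forall>p\<in>F. p < l" using assms(1) finite_nat_set_iff_bounded by auto
  have "F \<subseteq> (\<lambda>i. 2 * i + 1) ` {j+1..<j+1+l}"
  proof
    fix p assume p: "p \<in> F"
    then obtain i where "p = 2 * i + 1" using assms by (meson oddE)
    then show "p \<in> (\<lambda>i. 2 * i + 1) ` {j+1..<j+1+l}" using p l assms by force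
  qed
  then have "(\<Sum>p\<in>F. 1 / (real p)\<^sup>2) \<le> (\<Sum>p\<in>(\<lambda>i. 2 * i + 1) ` {j+1..<j+1+l}. 1 / (real p)\<^sup>2)"
    by (intro sum_mono2) auto
  also have "\<dots> = (\<Sum>i=j+1..<j+1+l. 1 / (real (2 * i + 1))\<^sup>2)"
    by (subst sum.reindex) (auto simp: inj_on_def)
  also have "\<dots> \<le> 1 / (4 * real j + 4)" using *[of l] by (smt (verit) divide_nonneg_nonneg of_nat_0_le_iff)
  finally show ?thesis .
qed

text \<open>The value has to stay below 2/9, for which the general bound 1/4 is too weak. So 3, 5, 7
  are taken exactly, the composite 9 is dropped, and the general bound is applied only from 11
  on.\<close>

lemma sum_inverse_odd_prime_squares_le:
  assumes "finite F" "F \<subseteq> odd_primes"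
  shows "(\<Sum>p\<in>F. 1 / (real p)\<^sup>2) \<le> 1 / 9 + 1 / 25 + 1 / 49 + 1 / 20"
proof -
  have "p \<in> {3, 5, 7} \<union> {p \<in> F. 9 < p}" if "p \<in> F" for p
  proof (cases "9 < p")
    case False
    moreover have "p \<in> odd_primes" using that assms by auto
    moreover have "\<not> prime (9::nat)" using prime_product[of 3 "3::nat"] by auto
    ultimately have "p \<in> {3..9}" "odd p" "p \<noteq> 9" using odd_primes_ge3[of p] by (auto simp: odd_primes_def)
    then have "p \<in> {3,4,5,6,7,8}" "odd p" by auto
    then show ?thesis by auto
  qed (use that in auto)
  then have "(\<Sum>p\<in>F. 1 / (real p)\<^sup>2) \<le> (\<Sum>p\<in>{3, 5, 7} \<union> {p \<in> F. 9 < p}. 1 / (real p)\<^sup>2)"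
    using assms by (intro sum_mono2) auto
  also have "\<dots> = (\<Sum>p\<in>{3, 5, 7}. 1 / (real p)\<^sup>2) + (\<Sum>p\<in>{p \<in> F. 9 < p}. 1 / (real p)\<^sup>2)"
    using assms by (intro sum.union_disjoint) auto
  also have "(\<Sum>p\<in>{p \<in> F. 9 < p}. 1 / (real p)\<^sup>2) \<le> 1 / 20"
    using sum_inverse_squares_le[of "{p \<in> F. 9 < p}" 4] assms by (auto simp: odd_primes_def)
  finally show ?thesis by simp
qed

lemma card_prime_divisors_le:
  fixes a :: nat
  assumes "0 < a" "a < 2 ^ Y"
  shows "card (prime_factors a) \<le> (Y::nat)"
proof -
  have "(2::nat) ^ card (prime_factors a) = (\<Prod>p\<in>prime_factors a. 2)" by simp
  also have "\<dots> \<le> (\<Prod>p\<in>prime_factors a. p ^ multiplicity p a)"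
  proof (intro prod_mono conjI)
    fix p assume p: "p \<in> prime_factors a"
    then have "2 \<le> p" using prime_ge_2_nat by auto
    moreover have "multiplicity p a > 0" using p by (simp add: prime_factors_multiplicity)
    ultimately show "2 \<le> p ^ multiplicity p a"
      by (metis dual_order.trans self_le_power less_imp_le_nat one_less_numeral_iff pos2 semiring_norm(76) order_less_le_trans)
  qed auto
  also have "\<dots> = a" using assms(1) by (metis prime_factorization_nat)
  finally have "(2::nat) ^ card (prime_factors a) < 2 ^ Y" using assms(2) by (rule le_less_trans)
  then have "card (prime_factors a) < Y" by (rule power_less_imp_less_exp[rotated]) simp
  then show ?thesis by simp
qed

text \<open>Each dyadic block contributes at most 1.\<close>

lemma harmonic_power2_le: "(\<Sum>i=1..<2 ^ Y. 1 / real i) \<le> real Y"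
proof (induction Y)
  case (Suc Y)
  let ?N = "2 ^ Y :: nat"
  have N: "?N \<ge> 1" by simp
  have "(\<Sum>i=1..<2 ^ Suc Y. 1 / real i) = (\<Sum>i=1..<?N. 1 / real i) + (\<Sum>i=?N..<?N + ?N. 1 / real i)"
    using N by (subst sum.atLeastLessThan_concat) (auto simp: mult_2)
  also have "(\<Sum>i=?N..<?N + ?N. 1 / real i) \<le> (\<Sum>i=?N..<?N + ?N. 1 / real ?N)"
    using N by (intro sum_mono divide_left_mono) (auto simp del: of_nat_power)
  also have "\<dots> = 1" using N by (simp del: of_nat_power)
  finally show ?case using Suc by simp
qed simp

text \<open>Indexing by \<open>j\<close> with limit \<open>2 * j + 1\<close> lets each step add at
  most one prime, \<open>2 * j + 3\<close>, and keeps the number of primes at most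
  \<open>j\<close>.\<close>

definition odd_primes_upto :: "nat \<Rightarrow> nat set" where
  "odd_primes_upto j = {p \<in> odd_primes. p \<le> 2 * j + 1}"

lemma finite_odd_primes_upto [simp]: "finite (odd_primes_upto j)"
  unfolding odd_primes_upto_def by simp

lemma odd_primes_upto_subset: "odd_primes_upto j \<subseteq> odd_primes"
  unfolding odd_primes_upto_def by auto

lemma card_odd_primes_upto_le: "card (odd_primes_upto j) \<le> j"
proof -
  have "odd_primes_upto j \<subseteq> {x. odd x \<and> 3 \<le> x \<and> x \<le> 2 * j + 1}"
    using odd_primes_ge3 by (auto simp: odd_primes_upto_def odd_primes_def)
  from card_odd_ge3_le[OF this] show ?thesis by auto
qed

lemma odd_primes_upto_0 [simp]: "odd_primes_upto 0 = {}"
  using odd_primes_ge3 by (fastforce simp: odd_primes_upto_def)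

lemma odd_primes_upto_Suc:
  "odd_primes_upto (Suc j)
    = (if 2 * j + 3 \<in> odd_primes then insert (2 * j + 3) (odd_primes_upto j) else odd_primes_upto j)"
proof -
  have "p \<le> 2 * j + 1 \<or> p = 2 * j + 3" if "p \<in> odd_primes" "p \<le> 2 * Suc j + 1" for p
    using that unfolding odd_primes_def by (auto elim!: oddE)
  then show ?thesis unfolding odd_primes_upto_def by auto
qed

definition odd_prime_divisors :: "nat \<Rightarrow> nat set" where
  "odd_prime_divisors a = {p \<in> odd_primes. p dvd a}"

subsection \<open>Two parity classes without coprime pairs\<close>

text \<open>The sets \<open>P\<close> and \<open>R\<close> stand for parity classes, not both even,
  so that a common factor may be taken odd. The hypothesis \<open>m \<le> card A + card B\<close> is
  the negation of the bound to be proved, and \<open>n < 2 ^ Y\<close> limits the number of prime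
  divisors to \<open>Y\<close>.\<close>

locale cross_noncoprime =
  fixes m n Y k :: nat and P R A B :: "nat set"
  assumes m: "m > 0"
    and P: "equidist m P" "P \<subseteq> {1..n}" and R: "equidist m R" "R \<subseteq> {1..n}"
    and n: "n < 2 ^ Y"
    and A: "A \<subseteq> P" and B: "B \<subseteq> R"
    and card: "m \<le> card A + card B"
    and cross: "\<And>a b. a \<in> A \<Longrightarrow> b \<in> B \<Longrightarrow> \<exists>p\<in>odd_primes. p dvd a \<and> p dvd b"
begin

text \<open>\<open>E\<close> is the truncation error and \<open>N\<close> the counting error of the
  sieve, uniform over sets of at most \<open>Y\<close> odd primes. \<open>\<eta>\<close> collects
  all errors of \<open>key_inequality\<close> after division by the square of
  \<open>m\<close>.\<close>

definition E :: real where "E = (ln (real (2 * Y + 1)) / 2) ^ k / fact k"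
definition N :: real where "N = real (Y + 1) ^ k"
definition \<eta> :: real where "\<eta> = 2 * E + (N * (real Y + 1) + real Y) / real m"
definition \<beta> :: real where "\<beta> = real (card B) / real m"

lemma finite_sets: "finite P" "finite R" "finite A" "finite B"
  using P R A B by (auto simp: equidist_def dest: finite_subset)

lemma card_sets: "card P = m" "card R = m" "card A \<le> m" "card B \<le> m"
  using P R A B card_mono[of P A] card_mono[of R B] finite_sets by (auto simp: equidist_def)

lemma E_nonneg: "E \<ge> 0" and N_nonneg: "N \<ge> 0"
  unfolding E_def N_def by auto

lemma \<beta>_bounds: "0 \<le> \<beta>" "\<beta> \<le> 1"
  unfolding \<beta>_def using card_sets m by auto

lemma E_N_le_\<eta>: "E + N / real m \<le> \<eta>"
proof -
  have "N / real m \<le> (N * (real Y + 1) + real Y) / real m"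
    using N_nonneg by (intro divide_right_mono) (auto simp: algebra_simps)
  then show ?thesis unfolding \<eta>_def using E_nonneg by simp
qed

lemma \<eta>_nonneg: "\<eta> \<ge> 0"
proof -
  have "0 \<le> E + N / real m" using E_nonneg N_nonneg by (intro add_nonneg_nonneg divide_nonneg_nonneg) auto
  then show ?thesis using E_N_le_\<eta> by linarith
qed

lemma odd_prime_divisors:
  assumes "a \<in> {1..n}"
  shows "finite (odd_prime_divisors a)" "card (odd_prime_divisors a) \<le> Y"
proof -
  have sub: "odd_prime_divisors a \<subseteq> prime_factors a"
    using assms by (auto simp: odd_prime_divisors_def odd_primes_def prime_factors_dvd)
  then show "finite (odd_prime_divisors a)" by (auto dest: finite_subset)
  have "card (odd_prime_divisors a) \<le> card (prime_factors a)" using sub by (intro card_mono) auto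
  also have "\<dots> \<le> Y" using assms n by (intro card_prime_divisors_le) auto
  finally show "card (odd_prime_divisors a) \<le> Y" .
qed

lemma sieve_error:
  assumes "finite Q" "Q \<subseteq> odd_primes" "card Q \<le> Y" "p = 1 \<or> p \<in> odd_primes - Q"
  shows "\<bar>real (card (sift Q {x \<in> P. p dvd x})) - real m / p * dens Q\<bar> \<le> real m / p * E + N"
proof -
  have "(\<Sum>q\<in>Q. 1 / real q) ^ k / fact k \<le> E"
    unfolding E_def using sum_inverse_le[OF assms(1-3)]
    by (intro divide_right_mono power_mono sum_nonneg) auto
  then have "real m / p * ((\<Sum>q\<in>Q. 1 / real q) ^ k / fact k) \<le> real m / p * E"
    by (intro mult_left_mono) auto
  moreover have "real (card Q + 1) ^ k \<le> N"
    unfolding N_def using assms by (intro power_mono) auto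
  ultimately show ?thesis using sieve_odd_primes[OF P(1) assms(1,2,4), of k] by linarith
qed

text \<open>Every element of \<open>B\<close> is a multiple of one of the at most \<open>Y\<close>
  odd prime divisors of \<open>a\<close>; counting the multiples of each one costs an error of
  1.\<close>

lemma card_B_le:
  assumes "a \<in> A"
  shows "real (card B) \<le> real m * (\<Sum>p\<in>odd_prime_divisors a. 1 / real p) + real Y"
proof -
  have a: "a \<in> {1..n}" using assms A P by auto
  note fin = odd_prime_divisors[OF a]
  have "B \<subseteq> (\<Union>p\<in>odd_prime_divisors a. {x \<in> R. p dvd x})"
    using cross[OF assms] B by (fastforce simp: odd_prime_divisors_def)
  then have "card B \<le> card (\<Union>p\<in>odd_prime_divisors a. {x \<in> R. p dvd x})"
    using fin finite_sets by (intro card_mono) auto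
  also have "\<dots> \<le> (\<Sum>p\<in>odd_prime_divisors a. card {x \<in> R. p dvd x})"
    using fin by (intro card_UN_le) auto
  finally have "real (card B) \<le> (\<Sum>p\<in>odd_prime_divisors a. real (card {x \<in> R. p dvd x}))"
    by (simp flip: of_nat_sum)
  also have "\<dots> \<le> (\<Sum>p\<in>odd_prime_divisors a. real m * (1 / real p) + 1)"
  proof (rule sum_mono)
    fix p assume "p \<in> odd_prime_divisors a"
    then have "odd p" by (auto simp: odd_prime_divisors_def odd_primes_def)
    then have "\<bar>real (card {x \<in> R. p dvd x}) - real m / real p\<bar> \<le> 1"
      using R(1) unfolding equidist_def by blast
    then show "real (card {x \<in> R. p dvd x}) \<le> real m * (1 / real p) + 1" by simp
  qed
  also have "\<dots> \<le> real m * (\<Sum>p\<in>odd_prime_divisors a. 1 / real p) + real Y"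
    using fin by (simp add: sum.distrib sum_distrib_left)
  finally show ?thesis .
qed

text \<open>After exchanging the sums, only primes above \<open>2 * j + 1\<close> occur. Each
  divides a proportion of about \<open>1 / p\<close> of the sifted elements and contributes
  \<open>1 / p\<close> for each, hence the squares. The bound \<open>\<tau>\<close> is a parameter
  because \<open>j = 0\<close> needs a sharper one.\<close>

lemma sum_over_sifted_le:
  assumes j: "j \<le> Y"
    and \<tau>: "\<And>F. finite F \<Longrightarrow> F \<subseteq> odd_primes \<Longrightarrow> \<forall>p\<in>F. 2 * j + 1 < p \<Longrightarrow> (\<Sum>p\<in>F. 1 / (real p)\<^sup>2) \<le> \<tau>"
  shows "(\<Sum>a\<in>sift (odd_primes_upto j) P. \<Sum>p\<in>odd_prime_divisors a. 1 / real p)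
    \<le> real m * (dens (odd_primes_upto j) + E) * \<tau> + N * real Y"
proof -
  let ?Q = "odd_primes_upto j"
  define G where "G = {p \<in> odd_primes. p \<le> n \<and> 2 * j + 1 < p}"
  have fin: "finite G" "finite (sift ?Q P)" using finite_sets unfolding G_def sift_def by auto
  have D: "dens ?Q \<ge> 0" using odd_primes_ge3 by (intro dens_bounds) (fastforce simp: odd_primes_upto_def)
  have "odd_prime_divisors a = {p. p \<in> G \<and> p dvd a}" if "a \<in> sift ?Q P" for a
  proof -
    have "a \<le> n" "a > 0" using that P by (auto simp: sift_def)
    then have "p \<le> n" if "p dvd a" for p using that dvd_imp_le le_trans by blast
    then show ?thesis using that
      by (auto simp: odd_prime_divisors_def G_def sift_def odd_primes_upto_def not_le)
  qed
  then have "(\<Sum>a\<in>sift ?Q P. \<Sum>p\<in>odd_prime_divisors a. 1 / real p)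
      = (\<Sum>a\<in>sift ?Q P. \<Sum>p | p \<in> G \<and> p dvd a. 1 / real p)" by (intro sum.cong) auto
  also have "\<dots> = (\<Sum>p\<in>G. \<Sum>a | a \<in> sift ?Q P \<and> p dvd a. 1 / real p)"
    using fin by (intro sum.swap_restrict)
  also have "\<dots> \<le> (\<Sum>p\<in>G. real m * (dens ?Q + E) * (1 / (real p)\<^sup>2) + N * (1 / real p))"
  proof (rule sum_mono)
    fix p assume p: "p \<in> G"
    then have "p \<ge> 3" using odd_primes_ge3 by (auto simp: G_def)
    have "{a. a \<in> sift ?Q P \<and> p dvd a} = sift ?Q {x \<in> P. p dvd x}" by (auto simp: sift_def)
    moreover have "real (card (sift ?Q {x \<in> P. p dvd x})) \<le> real m / p * (dens ?Q + E) + N"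
      using sieve_error[of ?Q p] p j card_odd_primes_upto_le[of j] odd_primes_upto_subset
      by (auto simp: G_def odd_primes_upto_def algebra_simps)
    ultimately have "(\<Sum>a | a \<in> sift ?Q P \<and> p dvd a. 1 / real p) \<le> (real m / p * (dens ?Q + E) + N) * (1 / real p)"
      by (simp add: divide_right_mono)
    also have "\<dots> = real m * (dens ?Q + E) * (1 / (real p)\<^sup>2) + N * (1 / real p)"
      using \<open>p \<ge> 3\<close> by (simp add: field_simps power2_eq_square)
    finally show "(\<Sum>a | a \<in> sift ?Q P \<and> p dvd a. 1 / real p) \<le> \<dots>" .
  qed
  also have "\<dots> = real m * (dens ?Q + E) * (\<Sum>p\<in>G. 1 / (real p)\<^sup>2) + N * (\<Sum>p\<in>G. 1 / real p)"
    by (simp add: sum.distrib sum_distrib_left)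
  also have "\<dots> \<le> real m * (dens ?Q + E) * \<tau> + N * real Y"
  proof (intro add_mono mult_left_mono)
    show "(\<Sum>p\<in>G. 1 / (real p)\<^sup>2) \<le> \<tau>" using fin by (intro \<tau>) (auto simp: G_def)
    have "(\<Sum>p\<in>G. 1 / real p) \<le> (\<Sum>i=1..<2 ^ Y. 1 / real i)"
      using n by (intro sum_mono2) (auto simp: G_def)
    then show "(\<Sum>p\<in>G. 1 / real p) \<le> real Y" using harmonic_power2_le[of Y] by linarith
  qed (use D E_nonneg N_nonneg in auto)
  finally show ?thesis .
qed

text \<open>The union bound \<open>card_B_le\<close> is averaged over the elements of \<open>A\<close> that survive the sieve
  up to \<open>2 * j + 1\<close>; by \<open>|A| + |B| \<ge> m\<close> at least \<open>(dens - \<beta>) * m\<close> of them survive, up to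
  errors.\<close>

lemma key_inequality:
  assumes j: "j \<le> Y" and "0 \<le> \<tau>" "\<tau> \<le> 1"
    and \<tau>: "\<And>F. finite F \<Longrightarrow> F \<subseteq> odd_primes \<Longrightarrow> \<forall>p\<in>F. 2 * j + 1 < p \<Longrightarrow> (\<Sum>p\<in>F. 1 / (real p)\<^sup>2) \<le> \<tau>"
  shows "\<beta> * (dens (odd_primes_upto j) - \<beta>) \<le> dens (odd_primes_upto j) * \<tau> + \<eta>"
proof -
  let ?Q = "odd_primes_upto j"
  define S where "S = sift ?Q P"
  define D where "D = dens ?Q"
  define M where "M = real m"
  define b where "b = real (card B)"
  define s where "s = real (card (A \<inter> S))"
  have M: "M > 0" unfolding M_def using m by simp
  have b: "0 \<le> b" "b \<le> M" unfolding b_def M_def using card_sets by auto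
  have S: "S \<subseteq> P" "finite S" using finite_sets unfolding S_def sift_def by auto
  have "M * D - M * E - N \<le> real (card S)"
    using sieve_error[of ?Q 1] j card_odd_primes_upto_le[of j] odd_primes_upto_subset[of j]
    by (auto simp: D_def M_def S_def)
  moreover have "card S + card A \<le> m + card (A \<inter> S)"
  proof -
    have "card A + card S = card (A \<union> S) + card (A \<inter> S)"
      using finite_sets S by (intro card_Un_Int)
    moreover have "card (A \<union> S) \<le> m" using card_mono[of P "A \<union> S"] A S finite_sets card_sets by simp
    ultimately show ?thesis by simp
  qed
  ultimately have s_ge: "M * D - b \<le> s + M * E + N" using card unfolding s_def b_def M_def by linarith
  have s_le: "s \<le> M"
    unfolding s_def M_def using card_mono[of A "A \<inter> S"] finite_sets card_sets(3) by simp
  have "b * s = (\<Sum>a\<in>A \<inter> S. b)" by (simp add: s_def)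
  also have "\<dots> \<le> (\<Sum>a\<in>A \<inter> S. M * (\<Sum>p\<in>odd_prime_divisors a. 1 / real p) + real Y)"
    unfolding b_def M_def using card_B_le by (intro sum_mono) auto
  also have "\<dots> = M * (\<Sum>a\<in>A \<inter> S. \<Sum>p\<in>odd_prime_divisors a. 1 / real p) + s * real Y"
    by (simp add: s_def sum.distrib sum_distrib_left)
  \<comment> \<open>Since the inner sums are nonnegative, \<open>A \<inter> S\<close> may be
    enlarged to \<open>S\<close>, where the sieve applies.\<close>
  also have "\<dots> \<le> M * (\<Sum>a\<in>S. \<Sum>p\<in>odd_prime_divisors a. 1 / real p) + M * real Y"
    using S M s_le by (intro add_mono mult_left_mono mult_right_mono sum_mono2 sum_nonneg) auto
  also have "\<dots> \<le> M * (M * (D + E) * \<tau> + N * real Y) + M * real Y"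
    using M sum_over_sifted_le[OF j \<tau>] unfolding S_def D_def M_def
    by (intro add_mono mult_left_mono) auto
  finally have 1: "b * s \<le> M * (M * (D + E) * \<tau> + N * real Y) + M * real Y" .
  have "b * (M * D - b) \<le> b * (s + M * E + N)" using s_ge b by (intro mult_left_mono)
  also have "\<dots> \<le> b * s + M * (M * E + N)"
    using b E_nonneg N_nonneg M mult_right_mono[of b M "M * E + N"] by (simp add: algebra_simps)
  also have "\<dots> \<le> M * (M * (D + E) * \<tau> + N * real Y) + M * real Y + M * (M * E + N)" using 1 by simp
  also have "\<dots> = M\<^sup>2 * D * \<tau> + M\<^sup>2 * (E * \<tau> + E) + M * (N * (real Y + 1) + real Y)"
    by (simp add: algebra_simps power2_eq_square)
  also have "\<dots> \<le> M\<^sup>2 * D * \<tau> + M\<^sup>2 * (2 * E) + M * (N * (real Y + 1) + real Y)"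
  proof -
    have "E * \<tau> + E \<le> 2 * E" using mult_left_mono[of \<tau> 1 E] E_nonneg assms(3) by simp
    then have "M\<^sup>2 * (E * \<tau> + E) \<le> M\<^sup>2 * (2 * E)" by (intro mult_left_mono) auto
    then show ?thesis by simp
  qed
  also have "M * (N * (real Y + 1) + real Y) = M\<^sup>2 * ((N * (real Y + 1) + real Y) / M)"
    using M by (simp add: power2_eq_square)
  also have "M\<^sup>2 * D * \<tau> + M\<^sup>2 * (2 * E) + M\<^sup>2 * ((N * (real Y + 1) + real Y) / M) = M\<^sup>2 * (D * \<tau> + \<eta>)"
    unfolding \<eta>_def M_def by (simp only: distrib_left mult.assoc add.assoc)
  finally have "b * (M * D - b) \<le> M\<^sup>2 * (D * \<tau> + \<eta>)" .
  moreover have "b = M * \<beta>" unfolding \<beta>_def b_def M_def using m by simp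
  then have "b * (M * D - b) = M\<^sup>2 * (\<beta> * (D - \<beta>))"
    by (simp add: power2_eq_square algebra_simps)
  ultimately show ?thesis using M unfolding D_def by simp
qed

text \<open>For a fixed \<open>b\<close> in \<open>B\<close>, the elements of \<open>P\<close> that
  share no odd prime with \<open>b\<close> lie outside \<open>A\<close>. Their number is then at
  most \<open>m - card A\<close>, hence at most \<open>card B\<close>.\<close>

lemma \<beta>_ge:
  assumes "B \<noteq> {}"
  shows "1 / sqrt (real (2 * Y + 1)) - \<eta> \<le> \<beta>"
proof -
  obtain b where b: "b \<in> B" using assms by blast
  then have "b \<in> {1..n}" using B R by auto
  note Q = odd_prime_divisors[OF this]
  let ?Q = "odd_prime_divisors b"
  have sub: "?Q \<subseteq> odd_primes" unfolding odd_prime_divisors_def by auto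
  define S where "S = sift ?Q P"
  have "A \<inter> S = {}" using cross[OF _ b] unfolding S_def sift_def odd_prime_divisors_def by blast
  moreover have "S \<subseteq> P" unfolding S_def sift_def by auto
  ultimately have "card A + card S \<le> m"
    using card_mono[of P "A \<union> S"] card_Un_disjoint[of A S] A finite_sets card_sets
      finite_subset[of S P] by simp
  then have "real (card S) \<le> real (card B)" using card by simp
  moreover have "real m * dens ?Q - real m * E - N \<le> real (card S)"
    using sieve_error[of ?Q 1] Q sub by (auto simp: S_def)
  moreover have "real m * (1 / sqrt (real (2 * Y + 1))) \<le> real m * dens ?Q"
    using dens_ge[OF Q(1) sub Q(2)] by (intro mult_left_mono) auto
  ultimately have "real m * (1 / sqrt (real (2 * Y + 1)) - E) - N \<le> real (card B)"
    by (simp add: algebra_simps)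
  then have "(real m * (1 / sqrt (real (2 * Y + 1)) - E) - N) / real m \<le> \<beta>"
    unfolding \<beta>_def by (intro divide_right_mono) auto
  moreover have "(real m * (1 / sqrt (real (2 * Y + 1)) - E) - N) / real m
      = 1 / sqrt (real (2 * Y + 1)) - E - N / real m"
    using m by (simp add: diff_divide_distrib)
  ultimately show ?thesis using E_N_le_\<eta> by linarith
qed

section \<open>Induction over the odd primes up to \<open>2 * Y + 1\<close>\<close>

context
  assumes half: "2 * card B \<le> m" and Y: "Y \<ge> 50" and \<eta>: "\<eta> \<le> 1 / (100 * real (2 * Y + 1))"
begin

lemma dens_upto_ge:
  assumes "j \<le> Y"
  shows "1 / sqrt (real (2 * j + 1)) \<le> dens (odd_primes_upto j)"
    "\<eta> / dens (odd_primes_upto j) \<le> 1 / (100 * sqrt (real (2 * j + 1)))"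
proof -
  define r where "r = sqrt (real (2 * j + 1))"
  have r: "r > 0" "r\<^sup>2 = real (2 * j + 1)" unfolding r_def by auto
  show D: "1 / sqrt (real (2 * j + 1)) \<le> dens (odd_primes_upto j)"
    using card_odd_primes_upto_le odd_primes_upto_subset by (intro dens_ge) auto
  have "\<eta> / dens (odd_primes_upto j) \<le> \<eta> / (1 / r)"
    using D r \<eta>_nonneg less_le_trans[of 0 "1 / r"] unfolding r_def[symmetric]
    by (intro divide_left_mono) (auto intro: divide_pos_pos)
  also have "\<dots> \<le> 1 / (100 * real (2 * Y + 1)) / (1 / r)" using \<eta> r by (intro divide_right_mono) auto
  also have "\<dots> \<le> 1 / (100 * r\<^sup>2) / (1 / r)"
    unfolding r(2) using r(1) assms by (intro divide_right_mono divide_left_mono) auto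
  also have "\<dots> = 1 / (100 * r)" using r(1) by (simp add: power2_eq_square)
  finally show "\<eta> / dens (odd_primes_upto j) \<le> 1 / (100 * sqrt (real (2 * j + 1)))" unfolding r_def .
qed

text \<open>\<open>x * (D - x)\<close> is increasing up to \<open>D / 2\<close>, so by \<open>key_inequality\<close> it suffices to compare its
  value at half of the next density with \<open>D * \<tau> + \<eta>\<close>. The tightest case is \<open>j = 0\<close>, where
  \<open>8 / 9\<close> has to exceed four times the sum of \<open>1 / p\<^sup>2\<close> over all odd primes.\<close>

lemma \<beta>_step:
  assumes j: "j < Y" and \<beta>: "\<beta> \<le> dens (odd_primes_upto j) / 2"
  shows "\<beta> \<le> dens (odd_primes_upto (Suc j)) / 2"
proof (cases "2 * j + 3 \<in> odd_primes")
  case True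
  define D where "D = dens (odd_primes_upto j)"
  define u where "u = 1 / real (2 * j + 3)"
  define r where "r = sqrt (real (2 * j + 1))"
  define \<tau> where "\<tau> = (if j = 0 then 1 / 9 + 1 / 25 + 1 / 49 + 1 / 20 else 1 / (4 * real j + 4))"
  have r: "r > 0" "r\<^sup>2 = real (2 * j + 1)" unfolding r_def by auto
  have D: "1 / r \<le> D" "\<eta> / D \<le> 1 / (100 * r)"
    using dens_upto_ge[of j] j unfolding D_def r_def by auto
  have Dpos: "D > 0" using D(1) r(1) less_le_trans[of 0 "1 / r" D] by simp
  have u: "0 < u" "u < 1" unfolding u_def by auto
  have D': "dens (odd_primes_upto (Suc j)) = D * (1 - u)"
    using True unfolding odd_primes_upto_Suc D_def u_def dens_def
    by (simp add: odd_primes_upto_def mult.commute)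
  show ?thesis
  proof (rule ccontr)
    assume "\<not> ?thesis"
    then have gt: "\<beta> > D * (1 - u) / 2" unfolding D' by simp
    have "\<beta> * (D - \<beta>) \<le> D * \<tau> + \<eta>"
      unfolding D_def
    proof (rule key_inequality)
      show "0 \<le> \<tau>" "\<tau> \<le> 1" by (auto simp: \<tau>_def)
      fix F assume F: "finite F" "F \<subseteq> odd_primes" "\<forall>p\<in>F. 2 * j + 1 < p"
      show "(\<Sum>p\<in>F. 1 / (real p)\<^sup>2) \<le> \<tau>"
        using sum_inverse_odd_prime_squares_le[OF F(1,2)] sum_inverse_squares_le[of F j] F
        by (auto simp: \<tau>_def odd_primes_def subset_iff)
    qed (use j in simp)
    moreover have "D * (1 - u) \<le> D" using Dpos u by (simp add: mult_left_le)
    then have "D - \<beta> - D * (1 - u) / 2 \<ge> 0"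
      using \<beta> unfolding D_def[symmetric] by linarith
    \<comment> \<open>This product is the difference of the values of \<open>x * (D - x)\<close> at
      \<open>\<beta>\<close> and at \<open>D * (1 - u) / 2\<close>; the latter value is
      \<open>D\<^sup>2 * (1 - u\<^sup>2) / 4\<close>.\<close>
    then have "0 \<le> (\<beta> - D * (1 - u) / 2) * (D - \<beta> - D * (1 - u) / 2)"
      using gt by (intro mult_nonneg_nonneg) auto
    moreover have "\<beta> * (D - \<beta>) = (\<beta> - D * (1 - u) / 2) * (D - \<beta> - D * (1 - u) / 2) + D\<^sup>2 * (1 - u\<^sup>2) / 4"
      by (simp add: field_simps power2_eq_square)
    ultimately have "D\<^sup>2 * (1 - u\<^sup>2) / 4 \<le> D * \<tau> + \<eta>" by linarith
    then have "D\<^sup>2 * (1 - u\<^sup>2) / 4 / D \<le> (D * \<tau> + \<eta>) / D" using Dpos by (intro divide_right_mono) auto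
    then have main: "D * (1 - u\<^sup>2) / 4 \<le> \<tau> + \<eta> / D"
      using Dpos by (simp add: power2_eq_square add_divide_distrib)
    show False
    proof (cases "j = 0")
      case True
      \<comment> \<open>Here \<open>main\<close> reads \<open>2 / 9 \<le> \<tau> + \<eta>\<close>,
        whereas \<open>\<tau> < 0.2216\<close> and \<open>\<eta> < 0.0001\<close>.\<close>
      have "D = 1" unfolding D_def True by (simp add: dens_def)
      moreover have "1 / (100 * real (2 * Y + 1)) \<le> 1 / 10100" using Y by (intro divide_left_mono) auto
      then have "\<eta> \<le> 1 / 10100" using \<eta> by linarith
      moreover have "u\<^sup>2 = 1 / 9" unfolding u_def True by (simp add: power2_eq_square)
      ultimately show False using main unfolding \<tau>_def True by simp
    next
      case False
      then have "r\<^sup>2 \<ge> 3" unfolding r by simp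
      then have "(1.7::real)\<^sup>2 \<le> r\<^sup>2" by (simp add: power2_eq_square)
      then have r17: "1.7 \<le> r" by (rule power2_le_imp_le) (use r(1) in simp)
      have "u \<le> 1 / 5" unfolding u_def using False by (intro divide_left_mono) auto
      then have "u\<^sup>2 \<le> (1 / 5)\<^sup>2" using u by (intro power_mono) auto
      then have "24 / 25 \<le> 1 - u\<^sup>2" by (simp add: power2_eq_square)
      then have "1 / r * (24 / 25) \<le> D * (1 - u\<^sup>2)" using D r Dpos by (intro mult_mono) auto
      moreover have "\<tau> = 1 / (2 * (r\<^sup>2 + 1))" unfolding \<tau>_def r using False by simp
      ultimately have "1 / r * (24 / 25) / 4 \<le> 1 / (2 * (r\<^sup>2 + 1)) + 1 / (100 * r)"
        using main D(2) by simp
      then have "1 / r * (23 / 100) \<le> 1 / (2 * (r\<^sup>2 + 1))" using r(1) by simp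
      then have *: "23 * (r\<^sup>2 + 1) \<le> 50 * r"
        using r(1) by (simp add: field_simps add_pos_pos)
      \<comment> \<open>This is the Taylor expansion of \<open>23 * (r\<^sup>2 + 1) - 50 * r\<close>
        at 1.7, with positive coefficients.\<close>
      have "0 < 23 * (r - 1.7)\<^sup>2 + (141 / 5) * (r - 1.7) + 447 / 100"
        using r17 by (intro add_nonneg_pos add_nonneg_nonneg) auto
      also have "\<dots> = 23 * (r\<^sup>2 + 1) - 50 * r"
        by (simp add: power2_eq_square field_simps)
      finally show False using * by linarith
    qed
  qed
qed (use \<beta> in \<open>simp add: odd_primes_upto_Suc\<close>)

text \<open>The induction starts from \<open>half\<close>, since the empty product gives density
  1.\<close>

lemma \<beta>_le_half_dens: "j \<le> Y \<Longrightarrow> \<beta> \<le> dens (odd_primes_upto j) / 2"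
proof (induction j)
  case 0
  show ?case using half m by (simp add: \<beta>_def dens_def field_simps)
next
  case (Suc j)
  then show ?case using \<beta>_step[of j] by simp
qed

text \<open>At \<open>j = Y\<close>, \<open>\<beta> \<le> D / 2\<close> turns
  \<open>key_inequality\<close> into \<open>\<beta> \<le> 2 * (\<tau> + \<eta> / D)\<close>. For
  \<open>r \<ge> 10\<close> this is at most \<open>0.12 / r\<close>, while a single element of
  \<open>B\<close> forces \<open>\<beta> \<ge> 0.99 / r\<close>.\<close>

lemma B_empty: "B = {}"
proof (rule ccontr)
  assume B: "B \<noteq> {}"
  define D where "D = dens (odd_primes_upto Y)"
  define r where "r = sqrt (real (2 * Y + 1))"
  have r: "r > 0" "r\<^sup>2 = real (2 * Y + 1)" unfolding r_def by auto
  have D: "1 / r \<le> D" "\<eta> / D \<le> 1 / (100 * r)"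
    using dens_upto_ge[of Y] unfolding D_def r_def by auto
  have Dpos: "D > 0" using D(1) r(1) less_le_trans[of 0 "1 / r" D] by simp
  define \<tau> where "\<tau> = 1 / (4 * real Y + 4)"
  have key: "\<beta> * (D - \<beta>) \<le> D * \<tau> + \<eta>"
    unfolding D_def
  proof (rule key_inequality)
    fix F assume F: "finite F" "F \<subseteq> odd_primes" "\<forall>p\<in>F. 2 * Y + 1 < p"
    then show "(\<Sum>p\<in>F. 1 / (real p)\<^sup>2) \<le> \<tau>"
      using sum_inverse_squares_le[of F Y] by (auto simp: \<tau>_def odd_primes_def subset_iff)
  qed (auto simp: \<tau>_def)
  have "\<beta> * (D / 2) \<le> \<beta> * (D - \<beta>)"
    using \<beta>_le_half_dens[of Y] \<beta>_bounds unfolding D_def[symmetric] by (intro mult_left_mono) auto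
  then have "\<beta> * (D / 2) \<le> D * \<tau> + \<eta>" using key by linarith
  then have "\<beta> * (D / 2) / D \<le> (D * \<tau> + \<eta>) / D" using Dpos by (intro divide_right_mono) auto
  then have "\<beta> / 2 \<le> \<tau> + \<eta> / D" using Dpos by (simp add: add_divide_distrib)
  moreover have "2 * \<tau> = 1 / (r\<^sup>2 + 1)" unfolding \<tau>_def r by (simp add: field_simps)
  moreover have "2 * (1 / (100 * r)) = 1 / (50 * r)" by simp
  ultimately have le: "\<beta> \<le> 1 / (r\<^sup>2 + 1) + 1 / (50 * r)" using D(2) by linarith
  have "10\<^sup>2 \<le> r\<^sup>2" unfolding r using Y by simp
  then have r10: "10 \<le> r" by (rule power2_le_imp_le) (use r(1) in simp)
  have "1 / r - \<eta> \<le> \<beta>" using \<beta>_ge[OF B] unfolding r_def .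
  moreover have "\<eta> \<le> 1 / (100 * r\<^sup>2)" using \<eta> unfolding r .
  moreover have "1 / (100 * r\<^sup>2) \<le> 1 / (100 * r)"
  proof (rule divide_left_mono)
    show "100 * r \<le> 100 * r\<^sup>2" using r10 by (simp add: power2_eq_square)
  qed (use r10 in auto)
  moreover have "1 / (r\<^sup>2 + 1) \<le> 1 / (10 * r)"
  proof (rule divide_left_mono)
    have "10 * r \<le> r * r" using r10 by (intro mult_right_mono) auto
    then show "10 * r \<le> r\<^sup>2 + 1" by (simp add: power2_eq_square)
    show "0 < (r\<^sup>2 + 1) * (10 * r)" using r10 by (intro mult_pos_pos) (auto intro: add_nonneg_pos)
  qed simp
  moreover have "1 / (10 * r) = (1 / r) / 10" "1 / (50 * r) = (1 / r) / 50" "1 / (100 * r) = (1 / r) / 100"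
    by simp_all
  moreover have "0 < 1 / r" using r(1) by simp
  ultimately show False using le by linarith
qed

end

end

text \<open>The hypotheses are symmetric, so \<open>B_empty\<close> applies to whichever of
  \<open>A\<close> and \<open>B\<close> has at most \<open>m / 2\<close> elements. If both are
  larger, \<open>B\<close> is first shrunk.\<close>

lemma card_add_card_less:
  fixes m n Y k :: nat and P R A B :: "nat set"
  assumes m: "m > 0"
    and P: "equidist m P" "P \<subseteq> {1..n}" and R: "equidist m R" "R \<subseteq> {1..n}"
    and n: "n < 2 ^ Y"
    and A: "A \<subseteq> P" "A \<noteq> {}" and B: "B \<subseteq> R" "B \<noteq> {}"
    and cross: "\<And>a b. a \<in> A \<Longrightarrow> b \<in> B \<Longrightarrow> \<exists>p\<in>odd_primes. p dvd a \<and> p dvd b"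
    and Y: "Y \<ge> 50"
    and small: "2 * ((ln (real (2 * Y + 1)) / 2) ^ k / fact k) + (real (Y + 1) ^ k * (real Y + 1) + real Y) / real m
      \<le> 1 / (100 * real (2 * Y + 1))"
  shows "card A + card B < m"
proof (rule ccontr)
  assume "\<not> ?thesis"
  then have card: "m \<le> card A + card B" by simp
  have empty: "B' = {}"
    if "equidist m P'" "P' \<subseteq> {1..n}" "equidist m R'" "R' \<subseteq> {1..n}" "A' \<subseteq> P'" "B' \<subseteq> R'"
      "m \<le> card A' + card B'" "2 * card B' \<le> m"
      "\<And>a b. a \<in> A' \<Longrightarrow> b \<in> B' \<Longrightarrow> \<exists>p\<in>odd_primes. p dvd a \<and> p dvd b"
    for P' R' A' B'
  proof -
    interpret cross_noncoprime m n Y k P' R' A' B'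
      by unfold_locales (use that m n in auto)
    show ?thesis
      by (rule B_empty) (use that Y small in \<open>auto simp: \<eta>_def E_def N_def\<close>)
  qed
  consider "2 * card B \<le> m" | "2 * card A \<le> m" | "2 * card A > m" "2 * card B > m" by linarith
  then show False
  proof cases
    case 1
    then show False using empty[OF P R A(1) B(1) card _ cross] B by auto
  next
    case 2
    have "A = {}" by (rule empty[OF R P B(1) A(1)]) (use card cross 2 in \<open>auto simp: conj_commute\<close>)
    then show False using A by simp
  next
    case 3
    \<comment> \<open>The smallness condition also forces \<open>m \<ge> Y\<close>, so the shrunken
      set below is nonempty.\<close>
    have "real Y / real m \<le> 2 * ((ln (real (2 * Y + 1)) / 2) ^ k / fact k)
        + (real (Y + 1) ^ k * (real Y + 1) + real Y) / real m"
      by (simp add: add_divide_distrib)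
    also have "\<dots> \<le> 1 / (100 * real (2 * Y + 1))" by (rule small)
    also have "\<dots> \<le> 1" using Y by simp
    finally have m2: "m \<ge> 2" using m Y by (simp add: field_simps)
    \<comment> \<open>With \<open>m div 2\<close> elements, \<open>B'\<close> is small enough for
      \<open>B_empty\<close>, and \<open>card A > m / 2\<close> keeps the total at least
      \<open>m\<close>.\<close>
    obtain B' where B': "B' \<subseteq> B" "card B' = m div 2"
      by (rule obtain_subset_with_card_n[of "m div 2" B]) (use 3 in auto)
    have "B' = {}"
      by (rule empty[OF P R A(1)]) (use B' B 3 cross in auto)
    then show False using B'(2) m2 by simp
  qed
qed

subsection \<open>Choice of the parameters and conclusion\<close>

lemma power_div_fact_le_exp:
  assumes "t \<ge> (0::real)"
  shows "t ^ k / fact k \<le> exp t"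
proof -
  have s: "(\<lambda>i. t ^ i / fact i) sums exp t"
    using exp_converges[of t] by (simp add: divide_inverse mult.commute scaleR_conv_of_real)
  show ?thesis
    using sum_le_suminf[OF sums_summable[OF s], of "{k}"] assms sums_unique[OF s] by simp
qed

text \<open>\<open>Y\<close> is about \<open>2 * ln n\<close>, which suffices as
  \<open>2 * ln 2 > 1\<close>. The depth \<open>k\<close> is about \<open>4 * L\<close> with
  \<open>L = ln (2 * Y + 1) \<le> 2 * ln (ln n)\<close>.\<close>

lemma sieve_parameters:
  fixes n m :: nat
  assumes n: "ln (real n) \<ge> 25" and m: "m > 0"
    and large: "real (2 * m) \<ge> exp (22 * (ln (ln (real n)))\<^sup>2)"
  obtains Y k :: nat where "Y \<ge> 50" "n < 2 ^ Y"
    "2 * ((ln (real (2 * Y + 1)) / 2) ^ k / fact k) + (real (Y + 1) ^ k * (real Y + 1) + real Y) / real m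
      \<le> 1 / (100 * real (2 * Y + 1))"
proof -
  define x where "x = ln (real n)"
  define Y where "Y = nat \<lceil>2 * x\<rceil>"
  define Z where "Z = real (2 * Y + 1)"
  define L where "L = ln Z"
  define k where "k = nat \<lceil>4 * L\<rceil>"
  have x: "x \<ge> 25" using n unfolding x_def .
  have Y: "2 * x \<le> real Y" "real Y \<le> 2 * x + 1" unfolding Y_def using x by linarith+
  have Y50: "Y \<ge> 50" using Y x by linarith
  have n0: "real n > 0" using x unfolding x_def by (cases "n = 0") auto
  have "real n = exp x" using n0 unfolding x_def by simp
  also have "\<dots> < exp (real Y * ln 2)"
  proof -
    have "ln (exp 1) < ln (4::real)" using exp_le by (subst ln_less_cancel_iff) auto
    moreover have "ln (4::real) = 2 * ln 2" using ln_realpow[of 2 2] by simp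
    ultimately have "x * 1 < x * (2 * ln 2)" using x by (intro mult_strict_left_mono) auto
    also have "\<dots> \<le> real Y * ln 2" using Y mult_right_mono[of "2 * x" "real Y" "ln 2"] by (simp add: mult_ac)
    finally show ?thesis by simp
  qed
  also have "\<dots> = 2 ^ Y" by (simp add: exp_of_nat_mult)
  finally have nY: "n < 2 ^ Y" by (metis of_nat_less_iff of_nat_numeral of_nat_power)
  have Z: "Z \<ge> 101" unfolding Z_def using Y50 by simp
  have Z0: "Z > 0" using Z by simp
  have expL: "exp L = Z" unfolding L_def using Z by simp
  have "exp 4 = exp (1::real) ^ 4" using exp_of_nat_mult[of 4 "1::real"] by simp
  also have "\<dots> \<le> 3 ^ 4" using exp_le by (intro power_mono) auto
  also have "\<dots> \<le> exp L" unfolding expL using Z by simp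
  finally have L: "L \<ge> 4" by simp
  have "Z \<le> 4 * x + 3" unfolding Z_def using Y by simp
  also have "\<dots> \<le> 5 * x" using x by simp
  also have "\<dots> \<le> x * x" using x by (intro mult_right_mono) auto
  finally have "Z \<le> x ^ 2" by (simp add: power2_eq_square)
  then have "L \<le> ln (x ^ 2)" unfolding L_def using Z0 by (intro ln_mono) auto
  also have "\<dots> = 2 * ln x" using x by (simp add: ln_realpow)
  finally have "L \<le> 2 * ln x" .
  then have "L\<^sup>2 \<le> (2 * ln x)\<^sup>2" using L by (intro power_mono) auto
  then have Lx: "L\<^sup>2 \<le> 4 * (ln x)\<^sup>2" by (simp add: power_mult_distrib)
  have k: "4 * L \<le> real k" "real k \<le> 4 * L + 1" unfolding k_def using L by linarith+
  have expkL: "exp (real i * L) = Z ^ i" for i by (simp add: exp_of_nat_mult expL)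
  have Z2: "400 \<le> Z\<^sup>2" using power_mono[OF Z, of 2] by simp

  \<comment> \<open>Inserting the factor \<open>exp 2\<close> into the power gains
    \<open>exp (- 2 * k)\<close>. As \<open>exp 2 \<le> 9\<close> and \<open>k \<ge> 4 * L\<close>,
    the exponent is at most \<open>4.5 * L - 8 * L\<close>.\<close>
  have "(L / 2) ^ k / fact k = (exp 2 * L / 2) ^ k / fact k * exp (- 2 * real k)"
    by (simp add: power_mult_distrib exp_minus power_divide exp_of_nat2_mult field_simps exp_of_nat_mult[symmetric] mult.commute)
  also have "\<dots> \<le> exp (exp 2 * L / 2) * exp (- 2 * real k)"
    using L by (intro mult_right_mono power_div_fact_le_exp) auto
  also have "\<dots> = exp (exp 2 * L / 2 - 2 * real k)" by (simp add: exp_add[symmetric])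
  also have "\<dots> \<le> exp (- (3 * L))"
  proof -
    have "exp 2 = exp (1::real) ^ 2" using exp_of_nat_mult[of 2 "1::real"] by simp
    also have "\<dots> \<le> 3 ^ 2" using exp_le by (intro power_mono) auto
    finally have "exp 2 * L \<le> 9 * L" using L by (intro mult_right_mono) auto
    then show ?thesis using k by (subst exp_le_cancel_iff) linarith
  qed
  also have "\<dots> = 1 / Z ^ 3" using expkL[of 3] by (simp add: exp_minus divide_inverse)
  also have "\<dots> \<le> 1 / (400 * Z)"
    using Z2 Z0 by (intro divide_left_mono) (auto simp: power3_eq_cube power2_eq_square)
  finally have E: "2 * ((L / 2) ^ k / fact k) \<le> 1 / (200 * Z)" by simp

  have "Z ^ (k + 5) = exp (real (k + 5) * L)" by (rule expkL[symmetric])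
  \<comment> \<open>Here \<open>k + 5 \<le> 4 * L + 6 \<le> 5.5 * L\<close> because
    \<open>L \<ge> 4\<close>. The constant 22 is \<open>5.5 * 4\<close>, from
    \<open>Lx\<close>.\<close>
  also have "real (k + 5) * L \<le> (5.5 * L) * L" using k L by (intro mult_right_mono) auto
  then have "exp (real (k + 5) * L) \<le> exp (22 * (ln x)\<^sup>2)" using Lx by (simp add: power2_eq_square)
  also have "\<dots> \<le> 2 * real m" using large unfolding x_def by simp
  finally have "Z ^ (k + 5) \<le> 2 * real m" .
  moreover have "2 * (400 * Z ^ (k + 2)) \<le> Z ^ (k + 5)"
  proof -
    have "2 * (400 * Z ^ (k + 2)) \<le> Z * (Z\<^sup>2 * Z ^ (k + 2))"
      using Z Z2 by (intro mult_mono) auto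
    also have "\<dots> = Z ^ (k + 5)" by (simp add: power_add power2_eq_square eval_nat_numeral)
    finally show ?thesis .
  qed
  ultimately have mZ: "400 * Z ^ (k + 2) \<le> real m" by simp
  have YZ: "real Y + 1 \<le> Z" unfolding Z_def by simp
  have "real (Y + 1) ^ k * (real Y + 1) + real Y \<le> Z ^ k * Z + Z"
    using YZ by (intro add_mono mult_mono power_mono) auto
  also have "\<dots> \<le> Z ^ k * Z + Z ^ k * Z" using Z one_le_power[of Z k] by simp
  also have "\<dots> = 2 * Z ^ (k + 1)" by simp
  finally have "(real (Y + 1) ^ k * (real Y + 1) + real Y) / real m \<le> 2 * Z ^ (k + 1) / real m"
    by (intro divide_right_mono) auto
  also have "\<dots> \<le> 2 * Z ^ (k + 1) / (400 * Z ^ (k + 2))"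
    using mZ Z0 m by (intro divide_left_mono) auto
  also have "\<dots> = 1 / (200 * Z)" using Z0 by simp
  finally have "2 * ((L / 2) ^ k / fact k) + (real (Y + 1) ^ k * (real Y + 1) + real Y) / real m
      \<le> 1 / (100 * Z)" using E by simp
  then show ?thesis using that Y50 nY unfolding L_def Z_def by blast
qed

lemma coprime_dichotomy:
  fixes m n Y k :: nat
  assumes m: "m > 0" and n: "n < 2 ^ Y" and Y: "Y \<ge> 50"
    and small: "2 * ((ln (real (2 * Y + 1)) / 2) ^ k / fact k) + (real (Y + 1) ^ k * (real Y + 1) + real Y) / real m
      \<le> 1 / (100 * real (2 * Y + 1))"
    and I: "I \<subseteq> {1..n}" "consecutive (2 * m) I" and J: "J \<subseteq> {1..n}" "consecutive (2 * m) J"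
    and S: "S \<subseteq> I" "S \<noteq> {}" and T: "T \<subseteq> J" "T \<noteq> {}"
    and card: "card S + card T \<ge> 2 * m"
    and nocop: "\<not> (\<exists>s\<in>S. \<exists>t\<in>T. coprime s t)"
  shows "S = I \<inter> {x. even x} \<and> T = J \<inter> {x. even x} \<and> card S + card T = 2 * m"
proof -
  define part where "part e X = {x \<in> X. x mod 2 = e}" for e :: nat and X :: "nat set"
  have equi: "equidist m (part e K)" if "consecutive (2 * m) K" "e < 2" for e K
    using that equidist_parity_class unfolding part_def consecutive_def by auto
  have finIJ: "finite I" "finite J" using I J finite_subset by blast+
  have fin: "finite S" "finite T" using S T finIJ finite_subset by blast+
  have cross: "card (part e S) + card (part f T) < m"
    if "e < 2" "f < 2" "e = 1 \<or> f = 1" "part e S \<noteq> {}" "part f T \<noteq> {}" for e f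
  proof (rule card_add_card_less[OF m, where P = "part e I" and R = "part f J" and n = n])
    fix a b assume ab: "a \<in> part e S" "b \<in> part f T"
    then have "\<not> coprime a b" using nocop by (auto simp: part_def)
    then have "gcd a b \<noteq> 1" using coprime_iff_gcd_eq_1 by blast
    then obtain p where p: "prime p" "p dvd gcd a b" using prime_factor_nat by blast
    \<comment> \<open>At least one of the two parity classes is odd, so 2 is not a common
      divisor.\<close>
    have "odd p"
    proof
      assume "even p"
      then have "even a" "even b" using p(2) by auto
      then show False using ab that(3) by (auto simp: part_def)
    qed
    then show "\<exists>p\<in>odd_primes. p dvd a \<and> p dvd b" using p by (auto simp: odd_primes_def)
  qed (use that equi I J S T n Y small in \<open>auto simp: part_def\<close>)
  have card_parts: "card X = card (part 0 X) + card (part 1 X)" if "finite X" for X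
  proof -
    have "X = part 0 X \<union> part 1 X" by (auto simp: part_def)
    moreover have "card (part 0 X \<union> part 1 X) = card (part 0 X) + card (part 1 X)"
      using that by (intro card_Un_disjoint) (auto simp: part_def)
    ultimately show ?thesis by simp
  qed
  have sub: "part e S \<subseteq> part e I" "part e T \<subseteq> part e J" for e using S T by (auto simp: part_def)
  have fin_parts: "finite (part e I)" "finite (part e J)" for e using finIJ by (auto simp: part_def)
  have cards: "card (part e I) = m" "card (part e J) = m" if "e < 2" for e
    using equi[OF I(2) that] equi[OF J(2) that] by (auto simp: equidist_def)
  have le: "card (part e S) \<le> m" "card (part e T) \<le> m" if "e < 2" for e
    using card_mono[OF fin_parts(1)[of e] sub(1)] card_mono[OF fin_parts(2)[of e] sub(2)] cards[OF that]
    by simp_all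
  have split: "card (part 0 S) + card (part 1 S) + (card (part 0 T) + card (part 1 T)) \<ge> 2 * m"
    using card card_parts fin by simp
  have ST: "part 0 S \<noteq> {} \<or> part 1 S \<noteq> {}" "part 0 T \<noteq> {} \<or> part 1 T \<noteq> {}"
    using S(2) T(2) card_parts fin by (auto simp: part_def)
  \<comment> \<open>If an odd part were nonempty, the four parts could be grouped into a pair
    covered by \<open>cross\<close>, with fewer than \<open>m\<close> elements, and a remaining pair
    with at most \<open>m\<close>, contradicting \<open>split\<close>.\<close>
  have "part 1 S = {} \<and> part 1 T = {}"
    using cross[of 1 1] cross[of 0 1] cross[of 1 0] le[of 0] le[of 1] split ST m
    by (cases "part 0 S = {}"; cases "part 1 S = {}"; cases "part 0 T = {}"; cases "part 1 T = {}") auto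
  then have odd_empty: "part 1 S = {}" "part 1 T = {}" by auto
  then have "card (part 0 S) = m" "card (part 0 T) = m" using split le[of 0] by auto
  then have eq: "part 0 S = part 0 I" "part 0 T = part 0 J"
    using card_subset_eq[OF fin_parts(1)[of 0] sub(1)] card_subset_eq[OF fin_parts(2)[of 0] sub(2)]
      cards[of 0] by simp_all
  have "part 0 X = X" if "part 1 X = {}" for X using that by (auto simp: part_def)
  from this[OF odd_empty(1)] this[OF odd_empty(2)]
  have "S = part 0 I" "T = part 0 J"
    unfolding eq by simp_all
  moreover have "part 0 K = K \<inter> {x. even x}" for K by (auto simp: part_def)
  ultimately show ?thesis using cards[of 0] by simp
qed

lemma exactly_one_4:
  "exactly_one [a, b, c, d] \<longleftrightarrow>
    a \<and> \<not> b \<and> \<not> c \<and> \<not> d \<or> \<not> a \<and> b \<and> \<not> c \<and> \<not> d \<or>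
    \<not> a \<and> \<not> b \<and> c \<and> \<not> d \<or> \<not> a \<and> \<not> b \<and> \<not> c \<and> d" (is "_ \<longleftrightarrow> ?rhs")
proof -
  have less4: "i < 4 \<longleftrightarrow> i = 0 \<or> i = 1 \<or> i = 2 \<or> i = 3" for i :: nat by auto
  have "exactly_one [a, b, c, d] \<longleftrightarrow> (\<exists>!i. i < 4 \<and> [a, b, c, d] ! i)"
    unfolding exactly_one_def by (simp add: numeral_eq_Suc)
  also have "\<dots> \<longleftrightarrow> ?rhs"
    unfolding Ex1_def less4
    by (cases a; cases b; cases c; cases d)
      (simp_all add: conj_disj_distribR conj_disj_distribL ex_disj_distrib all_conj_distrib imp_disjL
        numeral_2_eq_2 numeral_3_eq_3)
  finally show ?thesis .
qed

theorem theorem2p1: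
  "\<exists>C::real. \<forall>\<^sub>F n::nat in sequentially.
     \<forall>(m::nat) (I::nat set) (J::nat set).
       m > 0 \<longrightarrow> real (2 * m) \<ge> exp (C * (ln (ln (real n)))\<^sup>2) \<longrightarrow>
       I \<subseteq> {1..n} \<longrightarrow> J \<subseteq> {1..n} \<longrightarrow> consecutive (2 * m) I \<longrightarrow> consecutive (2 * m) J \<longrightarrow>
       (\<forall>S T. S \<subseteq> I \<longrightarrow> T \<subseteq> J \<longrightarrow>
          (card S + card T \<ge> 2 * m \<longrightarrow>
             exactly_one
               [S = {},
                T = {},
                S = I \<inter> {x. even x} \<and> T = J \<inter> {x. even x},
                \<exists>s\<in>S. \<exists>t\<in>T. coprime s t]) \<and>
          (card S + card T > 2 * m \<longrightarrow> (\<exists>s\<in>S. \<exists>t\<in>T. coprime s t)))"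
\<comment> \<open>The constant is the one in \<open>sieve_parameters\<close>.\<close>
proof (intro exI[of _ 22])
  have "filterlim (\<lambda>n. ln (real n)) at_top sequentially"
    by (rule filterlim_compose[OF ln_at_top filterlim_real_sequentially])
  then have "\<forall>\<^sub>F n in sequentially. ln (real n) \<ge> 25" by (simp add: filterlim_at_top)
  then show "\<forall>\<^sub>F n::nat in sequentially.
     \<forall>(m::nat) (I::nat set) (J::nat set).
       m > 0 \<longrightarrow> real (2 * m) \<ge> exp (22 * (ln (ln (real n)))\<^sup>2) \<longrightarrow>
       I \<subseteq> {1..n} \<longrightarrow> J \<subseteq> {1..n} \<longrightarrow> consecutive (2 * m) I \<longrightarrow> consecutive (2 * m) J \<longrightarrow>
       (\<forall>S T. S \<subseteq> I \<longrightarrow> T \<subseteq> J \<longrightarrow>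
          (card S + card T \<ge> 2 * m \<longrightarrow>
             exactly_one
               [S = {},
                T = {},
                S = I \<inter> {x. even x} \<and> T = J \<inter> {x. even x},
                \<exists>s\<in>S. \<exists>t\<in>T. coprime s t]) \<and>
          (card S + card T > 2 * m \<longrightarrow> (\<exists>s\<in>S. \<exists>t\<in>T. coprime s t)))"
  proof eventually_elim
    case (elim n)
    show ?case
    proof (intro allI impI)
      fix m :: nat and I J S T :: "nat set"
      assume m: "m > 0" and large: "real (2 * m) \<ge> exp (22 * (ln (ln (real n)))\<^sup>2)"
        and I: "I \<subseteq> {1..n}" and J: "J \<subseteq> {1..n}"
        and cI: "consecutive (2 * m) I" and cJ: "consecutive (2 * m) J"
        and S: "S \<subseteq> I" and T: "T \<subseteq> J"
      obtain Y k where params: "Y \<ge> 50" "n < 2 ^ Y"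
        "2 * ((ln (real (2 * Y + 1)) / 2) ^ k / fact k) + (real (Y + 1) ^ k * (real Y + 1) + real Y) / real m
          \<le> 1 / (100 * real (2 * Y + 1))"
        using sieve_parameters[OF elim m large] by blast
      have dich: "S = I \<inter> {x. even x} \<and> T = J \<inter> {x. even x} \<and> card S + card T = 2 * m"
        if "S \<noteq> {}" "T \<noteq> {}" "card S + card T \<ge> 2 * m" "\<not> (\<exists>s\<in>S. \<exists>t\<in>T. coprime s t)"
        using coprime_dichotomy[OF m params(2,1,3) I cI J cJ S that(1) T that(2-)] .
      have finIJ: "finite I" "finite J" using I J finite_subset by blast+
      have cards: "card I = 2 * m" "card J = 2 * m" using cI cJ by (auto simp: consecutive_def)
      have leS: "card S \<le> 2 * m" "card T \<le> 2 * m"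
        using card_mono[OF finIJ(1) S] card_mono[OF finIJ(2) T] cards by auto
      have even_ne: "K \<inter> {x. even x} \<noteq> {}" if K: "consecutive (2 * m) K" for K
      proof -
        obtain a where "K = {a..<a + 2 * m}" using K unfolding consecutive_def by blast
        \<comment> \<open>The witness is the least even number that is at least
          \<open>a\<close>.\<close>
        then have "2 * ((a + 1) div 2) \<in> K" using m by auto
        then show ?thesis by auto
      qed
      have no_coprime_even: "\<not> (\<exists>s\<in>S. \<exists>t\<in>T. coprime s t)"
        if "S = I \<inter> {x. even x}" "T = J \<inter> {x. even x}"
proof -
        have "\<not> coprime s t" if "even s" "even t" for s t :: nat
          using coprime_common_divisor[of s t 2] that by auto
        then show ?thesis using that by auto
      qed
      show "(card S + card T \<ge> 2 * m \<longrightarrow>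
             exactly_one
               [S = {},
                T = {},
                S = I \<inter> {x. even x} \<and> T = J \<inter> {x. even x},
                \<exists>s\<in>S. \<exists>t\<in>T. coprime s t]) \<and>
          (card S + card T > 2 * m \<longrightarrow> (\<exists>s\<in>S. \<exists>t\<in>T. coprime s t))"
      proof (intro conjI impI)
        assume big: "card S + card T \<ge> 2 * m"
        \<comment> \<open>The other overlaps are excluded because the even parts of \<open>I\<close>
          and \<open>J\<close> are nonempty and contain no coprime pair, and an empty set admits no
          pair at all.\<close>
        have "\<not> (S = {} \<and> T = {})" using big m by auto
        then show "exactly_one
               [S = {},
                T = {},
                S = I \<inter> {x. even x} \<and> T = J \<inter> {x. even x},
                \<exists>s\<in>S. \<exists>t\<in>T. coprime s t]"
          unfolding exactly_one_4 using dich big even_ne[OF cI] even_ne[OF cJ] no_coprime_even by blast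
      next
        assume big: "card S + card T > 2 * m"
        then have "S \<noteq> {}" "T \<noteq> {}" using leS by auto
        then show "\<exists>s\<in>S. \<exists>t\<in>T. coprime s t" using dich big by fastforce
      qed
    qed
  qed
qed

end
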